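(* Let $X$ be a locally compact Hausdorff space. Suppose that for some $x_0\in X$ there exists a continuous injective monoid homomorphism $F:([0,\infty),\times)\to(C_{x_0}(X),\circ)$ such that $F(0)$ is the constant map with value $x_0$ and $F(1)=\mathrm{Id}_X$. Suppose there is a compact set $D\subset X$ such that $x_0\in\mathrm{Int}(D)$ and $F[0,1)(D)\subset\mathrm{Int}(D)$, where $F[0,1)(D)=\bigcup_{\alpha\in[0,1)}F(\alpha)(D)$. Then $F[0,1)(D)=\mathrm{Int}(D)$, and the function $f':\mathcal{C}_{x_0}([0,\infty),\mathrm{Bd}(D))\to X$ defined by $x_0\mapsto x_0$ and $(\alpha,c)\mapsto F(\alpha)(c)$ for $\alpha\in(0,\infty)$, $c\in\mathrm{Bd}(D)$, is a homeomorphism.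
   Context: $C_{x_0}(X)$ is the set of continuous maps $f:X\to X$ with $f(x_0)=x_0$, a monoid under composition, equipped with the subspace topology induced by the compact-open topology. The monoid $([0,\infty),\times)$ is $[0,\infty)$ with multiplication and the usual topology. $\mathrm{Int}$ and $\mathrm{Bd}$ denote topological interior and boundary in $X$. Cone: for a topological space $C$, a set $I\subset\mathbb{R}_{\ge0}$ containing $0$, and a point $p$, $\mathcal{C}_p(I,C)$ is the quotient space obtained from $I\times C$ by identifying $\{0\}\times C$ to the single point $p$; as a set it is $\{p\}\sqcup (I\setminus\{0\})\times C$, and it carries the quotient topology. *)

theory Defs
  imports "HOL-Analysis.Analysis" "HOL-Algebra.Group"
begin

text \<open>Spaces are abstract topologies, so a continuous map is represented by its unique extensional
  representative (\<open>undefined\<close> outside the carrier); equality of such representatives is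
  equality of maps.\<close>

definition continuous_maps :: "'a topology \<Rightarrow> 'b topology \<Rightarrow> ('a \<Rightarrow> 'b) set"
  where "continuous_maps X Y = {f \<in> extensional (topspace X). continuous_map X Y f}"

definition compact_open_topology :: "'a topology \<Rightarrow> 'b topology \<Rightarrow> ('a \<Rightarrow> 'b) topology"
  where "compact_open_topology X Y =
    topology_generated_by
      {{f \<in> continuous_maps X Y. f ` K \<subseteq> U} | K U. compactin X K \<and> openin Y U}"

definition pointed_maps :: "'a topology \<Rightarrow> 'a \<Rightarrow> ('a \<Rightarrow> 'a) set"
  where "pointed_maps X x0 = {f \<in> continuous_maps X X. f x0 = x0}"

definition pointed_maps_topology :: "'a topology \<Rightarrow> 'a \<Rightarrow> ('a \<Rightarrow> 'a) topology"
  where "pointed_maps_topology X x0 = subtopology (compact_open_topology X X) (pointed_maps X x0)"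

definition pointed_maps_monoid :: "'a topology \<Rightarrow> 'a \<Rightarrow> ('a \<Rightarrow> 'a) monoid"
  where "pointed_maps_monoid X x0 =
    \<lparr>carrier = pointed_maps X x0, mult = compose (topspace X), one = (\<lambda>x\<in>topspace X. x)\<rparr>"

definition nonneg_real_monoid :: "real monoid"
  where "nonneg_real_monoid = \<lparr>carrier = {0..}, mult = (*), one = 1\<rparr>"

lemma topspace_compact_open_topology [simp]:
  "topspace (compact_open_topology X Y) = continuous_maps X Y"
proof -
  have "continuous_maps X Y \<in>
      {{f \<in> continuous_maps X Y. f ` K \<subseteq> U} | K U. compactin X K \<and> openin Y U}"
    by (rule CollectI, rule exI[of _ "{}"], rule exI[of _ "{}"]) auto
  then show ?thesis
    unfolding compact_open_topology_def topology_generated_by_topspace by blast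
qed

lemma topspace_pointed_maps_topology [simp]:
  "topspace (pointed_maps_topology X x0) = pointed_maps X x0"
  by (auto simp: pointed_maps_topology_def pointed_maps_def)

lemma monoid_pointed_maps_monoid:
  assumes "x0 \<in> topspace X"
  shows "monoid (pointed_maps_monoid X x0)"
proof -
  have cm: "continuous_map X X (compose (topspace X) g f)"
    if "continuous_map X X f" "continuous_map X X g" for f g
    using continuous_map_compose[OF that]
    by (rule continuous_map_eq) (simp add: compose_eq)
  have id: "continuous_map X X (\<lambda>x\<in>topspace X. x)"
    by (rule continuous_map_eq[OF continuous_map_id]) simp
  have "compose (topspace X) (compose (topspace X) h g) f =
      compose (topspace X) h (compose (topspace X) g f)" if "continuous_map X X f" for f g h
    using that continuous_map_image_subset_topspace[OF that]
    by (auto simp: compose_def fun_eq_iff restrict_def)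
  moreover have "compose (topspace X) (\<lambda>x\<in>topspace X. x) f = f"
    if "continuous_map X X f" "f \<in> extensional (topspace X)" for f
    using continuous_map_image_subset_topspace[OF that(1)] that(2)
    by (auto simp: compose_def fun_eq_iff restrict_def extensional_def)
  moreover have "compose (topspace X) f (\<lambda>x\<in>topspace X. x) = f"
    if "f \<in> extensional (topspace X)" for f
    using that by (auto simp: compose_def fun_eq_iff restrict_def extensional_def)
  ultimately show ?thesis
    using assms cm id
    by unfold_locales
       (auto simp: pointed_maps_monoid_def pointed_maps_def continuous_maps_def compose_eq)
qed

lemma monoid_nonneg_real_monoid: "monoid nonneg_real_monoid"
  by unfold_locales (auto simp: nonneg_real_monoid_def)

text \<open>For \<open>0 \<in> I\<close> this is the cone over \<open>C\<close> with apex \<open>p\<close>. The apex is always a point of the cone,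
  also when \<open>C\<close> is empty.\<close>

definition cone_carrier :: "'p \<Rightarrow> real set \<Rightarrow> 'c topology \<Rightarrow> ('p + real \<times> 'c) set"
  where "cone_carrier p I C = {p} <+> (I - {0}) \<times> topspace C"

definition cone_proj :: "'p \<Rightarrow> real \<times> 'c \<Rightarrow> 'p + real \<times> 'c"
  where "cone_proj p z = (if fst z = 0 then Inl p else Inr z)"

definition cone_topology :: "'p \<Rightarrow> real set \<Rightarrow> 'c topology \<Rightarrow> ('p + real \<times> 'c) topology"
  where "cone_topology p I C = topology (\<lambda>U. U \<subseteq> cone_carrier p I C \<and>
    openin (prod_topology (top_of_set I) C) {z \<in> I \<times> topspace C. cone_proj p z \<in> U})"

lemma openin_cone_topology:
  "openin (cone_topology p I C) U \<longleftrightarrow> U \<subseteq> cone_carrier p I C \<and>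
    openin (prod_topology (top_of_set I) C) {z \<in> I \<times> topspace C. cone_proj p z \<in> U}"
proof -
  let ?P = "prod_topology (top_of_set I) C"
  let ?pre = "\<lambda>U. {z \<in> I \<times> topspace C. cone_proj p z \<in> U}"
  have Int: "?pre (S \<inter> T) = ?pre S \<inter> ?pre T" for S T by auto
  have Un: "?pre (\<Union>\<K>) = \<Union>(?pre ` \<K>)" for \<K> by auto
  have "istopology (\<lambda>U. U \<subseteq> cone_carrier p I C \<and> openin ?P (?pre U))"
    unfolding istopology_def Int Un by (auto intro!: openin_Int openin_Union)
  then show ?thesis
    unfolding cone_topology_def by (simp add: topology_inverse')
qed

lemma topspace_cone_topology [simp]: "topspace (cone_topology p I C) = cone_carrier p I C"
proof -
  have "{z \<in> I \<times> topspace C. cone_proj p z \<in> cone_carrier p I C} =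
      topspace (prod_topology (top_of_set I) C)"
    by (auto simp: cone_proj_def cone_carrier_def)
  then have "openin (cone_topology p I C) (cone_carrier p I C)"
    unfolding openin_cone_topology using openin_topspace[of "prod_topology (top_of_set I) C"] by simp
  then show ?thesis
    by (metis openin_cone_topology openin_subset openin_topspace subset_antisym)
qed

lemma quotient_map_cone_proj:
  assumes "0 \<in> I" and "topspace C \<noteq> {}"
  shows "quotient_map (prod_topology (top_of_set I) C) (cone_topology p I C) (cone_proj p)"
proof -
  have "cone_proj p ` (I \<times> topspace C) = cone_carrier p I C"
  proof
    show "cone_proj p ` (I \<times> topspace C) \<subseteq> cone_carrier p I C"
      by (auto simp: cone_proj_def cone_carrier_def)
    show "cone_carrier p I C \<subseteq> cone_proj p ` (I \<times> topspace C)"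
    proof
      fix z assume "z \<in> cone_carrier p I C"
      then consider "z = Inl p" | t c where "z = Inr (t, c)" "t \<in> I" "t \<noteq> 0" "c \<in> topspace C"
        by (auto simp: cone_carrier_def)
      then show "z \<in> cone_proj p ` (I \<times> topspace C)"
      proof cases
        case 1
        obtain c where "c \<in> topspace C" using assms by blast
        with 1 assms show ?thesis by (force simp: cone_proj_def intro!: image_eqI[of _ _ "(0, c)"])
      next
        case 2
        then show ?thesis by (force simp: cone_proj_def intro!: image_eqI[of _ _ "(t, c)"])
      qed
    qed
  qed
  then show ?thesis
    by (simp add: quotient_map_def openin_cone_topology)
qed

end

theory Submission
  imports Defs
begin

text \<open>Since \<open>X\<close> is locally compact Hausdorff, evaluation is jointly continuous and \<open>F\<close> is a continuous
  action of the multiplicative monoid of nonnegative reals on \<open>X\<close>. For \<open>x \<noteq> x0\<close> the set of times \<open>t\<close>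
  with \<open>F t x \<in> D\<close> is a compact interval \<open>[0, T]\<close>: it is bounded because \<open>F t\<close> shrinks the compact set
  \<open>D\<close> into any neighbourhood of \<open>x0\<close> as \<open>t \<rightarrow> 0\<close>. The orbit lies in the interior of \<open>D\<close> exactly
  for \<open>t < T\<close>, so it meets the frontier exactly at time \<open>T\<close>, whence bijectivity. The same shrinking
  property for an arbitrary compact set shows that \<open>(t, c) \<mapsto> F t c\<close> is proper on \<open>[0, \<infinity>) \<times> Bd D\<close>, hence
  a quotient map, and it factors through the projection onto the cone.\<close>

text \<open>A compact neighbourhood \<open>K\<close> of \<open>x\<close> fits inside the preimage of
  \<open>U\<close> under \<open>f\<close>. The subbasic set of maps sending \<open>K\<close> into
  \<open>U\<close>, times an open \<open>V\<close> with \<open>x\<close> in \<open>V\<close> and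
  \<open>V \<subseteq> K\<close>, is then a neighbourhood of \<open>(f, x)\<close> that evaluation
  sends into \<open>U\<close>.\<close>

lemma continuous_map_compact_open_evaluation:
  assumes "neighbourhood_base_of (compactin X) X"
  shows "continuous_map (prod_topology (compact_open_topology X Y) X) Y (\<lambda>(f, x). f x)"
  unfolding continuous_map_def
proof (intro conjI allI impI)
  show "(\<lambda>(f, x). f x) \<in> topspace (prod_topology (compact_open_topology X Y) X) \<rightarrow> topspace Y"
    by (auto simp: continuous_maps_def dest: continuous_map_funspace)
next
  fix U assume U: "openin Y U"
  let ?P = "{z \<in> topspace (prod_topology (compact_open_topology X Y) X). (case z of (f, x) \<Rightarrow> f x) \<in> U}"
  show "openin (prod_topology (compact_open_topology X Y) X) ?P"
    unfolding openin_prod_topology_alt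
  proof (intro allI impI)
    fix f x assume "(f, x) \<in> ?P"
    then have f: "f \<in> continuous_maps X Y" "continuous_map X Y f" and x: "x \<in> topspace X" "f x \<in> U"
      by (auto simp: continuous_maps_def)
    have "openin X {y \<in> topspace X. f y \<in> U}"
      using f U by (simp add: continuous_map_def)
    then obtain V K where VK: "openin X V" "compactin X K" "x \<in> V" "V \<subseteq> K" "K \<subseteq> {y \<in> topspace X. f y \<in> U}"
      using assms x unfolding neighbourhood_base_of by (metis (mono_tags, lifting) mem_Collect_eq)
    let ?N = "{g \<in> continuous_maps X Y. g ` K \<subseteq> U}"
    have "openin (compact_open_topology X Y) ?N"
      unfolding compact_open_topology_def
      by (rule topology_generated_by_Basis) (use VK U in blast)
    moreover have "f \<in> ?N" using f VK by auto
    moreover have "?N \<times> V \<subseteq> ?P" using VK by auto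
    ultimately show "\<exists>N V. openin (compact_open_topology X Y) N \<and> openin X V \<and> f \<in> N \<and> x \<in> V \<and> N \<times> V \<subseteq> ?P"
      using VK by blast
  qed
qed

section \<open>The monoid action and its elementary laws\<close>

locale contracting_action =
  fixes X :: "'a topology" and x0 :: 'a and F :: "real \<Rightarrow> 'a \<Rightarrow> 'a" and D :: "'a set"
  assumes locally_compact: "locally_compact_space X" and Hausdorff: "Hausdorff_space X"
    and x0: "x0 \<in> topspace X"
    and continuous_F: "continuous_map (top_of_set {0..}) (pointed_maps_topology X x0) F"
    and inj_F: "inj_on F {0..}"
    and hom_F: "F \<in> hom nonneg_real_monoid (pointed_maps_monoid X x0)"
    and F_zero: "F 0 = (\<lambda>x\<in>topspace X. x0)"
    and F_one: "F 1 = (\<lambda>x\<in>topspace X. x)"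
    and compact_D: "compactin X D"
    and x0_interior: "x0 \<in> X interior_of D"
    and contracting: "(\<Union>\<alpha>\<in>{0..<1}. F \<alpha> ` D) \<subseteq> X interior_of D"
begin

lemma F_pointed: "0 \<le> t \<Longrightarrow> F t \<in> pointed_maps X x0"
  using hom_F by (auto simp: hom_def nonneg_real_monoid_def pointed_maps_monoid_def)

lemma F_closed: "0 \<le> t \<Longrightarrow> x \<in> topspace X \<Longrightarrow> F t x \<in> topspace X"
  using F_pointed[of t] by (auto simp: pointed_maps_def continuous_maps_def dest: continuous_map_funspace)

lemma F_base: "0 \<le> t \<Longrightarrow> F t x0 = x0"
  using F_pointed[of t] by (auto simp: pointed_maps_def)

lemma F_mult:
  assumes "0 \<le> s" "0 \<le> t" "x \<in> topspace X"
  shows "F (s * t) x = F s (F t x)"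
proof -
  have "F (s * t) = compose (topspace X) (F s) (F t)"
    using hom_F assms by (auto simp: hom_def nonneg_real_monoid_def pointed_maps_monoid_def)
  then show ?thesis using assms by (simp add: compose_eq)
qed

lemma F_inverse: "0 < t \<Longrightarrow> x \<in> topspace X \<Longrightarrow> F (1 / t) (F t x) = x"
  using F_mult[of "1 / t" t x] F_one by simp

lemma F_eq_base_iff: "0 < t \<Longrightarrow> x \<in> topspace X \<Longrightarrow> F t x = x0 \<longleftrightarrow> x = x0"
  by (metis F_base F_inverse divide_nonneg_pos less_eq_real_def zero_le_one)

lemma closedin_D: "closedin X D"
  using Hausdorff compact_D by (rule compactin_imp_closedin)

lemma D_subset: "D \<subseteq> topspace X"
  using closedin_D by (rule closedin_subset)

lemma frontier_eq: "X frontier_of D = D - X interior_of D"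
  using closedin_D by (simp add: frontier_of_def closure_of_closedin)

lemma compactin_frontier: "compactin X (X frontier_of D)"
  using compact_D closedin_frontier_of frontier_of_subset_closedin[OF closedin_D]
  by (blast intro: closed_compactin)

lemma continuous_action:
  "continuous_map (prod_topology (top_of_set {0..}) X) X (\<lambda>(t, x). F t x)"
proof -
  have base: "neighbourhood_base_of (compactin X) X"
    using locally_compact Hausdorff locally_compact_space_neighbourhood_base by blast
  have F: "continuous_map (top_of_set {0..}) (compact_open_topology X X) F"
    using continuous_F by (simp add: pointed_maps_topology_def continuous_map_in_subtopology)
  have "continuous_map (prod_topology (top_of_set {0..}) X) (prod_topology (compact_open_topology X X) X)
      (\<lambda>z. (F (fst z), snd z))"
    using continuous_map_compose[OF continuous_map_fst F]
    by (simp add: continuous_map_paired continuous_map_snd o_def)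
  from continuous_map_compose[OF this continuous_map_compact_open_evaluation[OF base]]
  show ?thesis by (simp add: o_def case_prod_beta')
qed

text \<open>\<open>F 0\<close> is constant with value \<open>x0\<close>, so it lies in the subbasic
  open set of maps sending \<open>K\<close> into \<open>V\<close>. Continuity of \<open>F\<close> at
  time 0 gives one \<epsilon> that serves all points of \<open>K\<close>.\<close>

lemma shrinks_into_neighbourhood:
  assumes "compactin X K" "openin X V" "x0 \<in> V"
  obtains \<epsilon> where "0 < \<epsilon>" "\<And>t x. 0 \<le> t \<Longrightarrow> t < \<epsilon> \<Longrightarrow> x \<in> K \<Longrightarrow> F t x \<in> V"
proof -
  let ?N = "{g \<in> continuous_maps X X. g ` K \<subseteq> V}"
  have "openin (compact_open_topology X X) ?N"
    unfolding compact_open_topology_def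
    by (rule topology_generated_by_Basis) (use assms in blast)
  moreover have "continuous_map (top_of_set {0..}) (compact_open_topology X X) F"
    using continuous_F by (simp add: pointed_maps_topology_def continuous_map_in_subtopology)
  ultimately have "openin (top_of_set {0..}) {t \<in> {0..}. F t \<in> ?N}"
    by (force simp: continuous_map_def)
  moreover have "0 \<in> {t \<in> {0..}. F t \<in> ?N}"
    using F_pointed[of 0] assms compactin_subset_topspace[OF assms(1)]
    by (auto simp: pointed_maps_def F_zero)
  ultimately obtain \<epsilon> where \<epsilon>: "0 < \<epsilon>" "ball 0 \<epsilon> \<inter> {0..} \<subseteq> {t \<in> {0..}. F t \<in> ?N}"
    by (meson openin_contains_ball)
  have "F t x \<in> V" if "0 \<le> t" "t < \<epsilon>" "x \<in> K" for t x
  proof -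
    have "t \<in> ball 0 \<epsilon> \<inter> {0..}" using that by (simp add: dist_real_def)
    then have "F t ` K \<subseteq> V" using \<epsilon> by blast
    then show ?thesis using that by blast
  qed
  then show thesis using \<epsilon>(1) that by blast
qed

section \<open>Orbits and the time at which they meet the frontier\<close>

lemma continuous_orbit:
  assumes "x \<in> topspace X"
  shows "continuous_map (top_of_set {0..}) X (\<lambda>t. F t x)"
proof -
  have "continuous_map (top_of_set {0..}) (prod_topology (top_of_set {0..}) X) (\<lambda>t. (t, x))"
    using assms by (simp add: continuous_map_paired)
  from continuous_map_compose[OF this continuous_action] show ?thesis by (simp add: o_def)
qed

text \<open>An earlier point of the orbit is the image of a later one under
  \<open>F (s / t)\<close>, where \<open>s / t < 1\<close>, so the contraction hypothesis
  applies.\<close>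

lemma orbit_interior:
  assumes "0 \<le> s" "s < t" "x \<in> topspace X" "F t x \<in> D"
  shows "F s x \<in> X interior_of D"
proof -
  have "F s x = F (s / t) (F t x)"
    using F_mult[of "s / t" t x] assms by simp
  moreover have "s / t \<in> {0..<1}" using assms by simp
  ultimately show ?thesis using contracting assms by blast
qed

lemma frontier_time_unique:
  assumes "0 \<le> s" "0 \<le> t" "x \<in> topspace X" "F s x \<in> X frontier_of D" "F t x \<in> X frontier_of D"
  shows "s = t"
  using assms orbit_interior[of s t x] orbit_interior[of t s x]
  by (cases s t rule: linorder_cases) (auto simp: frontier_eq)

lemma base_notin_frontier: "x0 \<notin> X frontier_of D"
  using x0_interior by (simp add: frontier_eq)

text \<open>The witness is the last time at which the orbit is in \<open>D\<close>.\<close>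

lemma frontier_time_exists:
  assumes x: "x \<in> topspace X" "x \<noteq> x0"
  obtains T where "0 < T" "F T x \<in> X frontier_of D"
proof -
  define S where "S = {t \<in> {0..}. F t x \<in> D}"
  have zero: "0 \<in> S"
    using x x0_interior interior_of_subset[of X D] by (auto simp: S_def F_zero)
  have "closedin X {x}"
    using Hausdorff x by (simp add: closedin_Hausdorff_singleton)
  then have "openin X (topspace X - {x})" by blast
  then obtain \<epsilon> where \<epsilon>: "0 < \<epsilon>" "\<And>t y. 0 \<le> t \<Longrightarrow> t < \<epsilon> \<Longrightarrow> y \<in> D \<Longrightarrow> F t y \<in> topspace X - {x}"
    using shrinks_into_neighbourhood[OF compact_D, of "topspace X - {x}"] x0 x by blast
  \<comment> \<open>If \<open>t\<close> were larger, \<open>F (1 / t)\<close> would push the point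
    \<open>F t x\<close> of \<open>D\<close> away from \<open>x\<close>, yet it undoes
    \<open>F t\<close>.\<close>
  have bound: "t \<le> 1 / \<epsilon>" if "t \<in> S" for t
  proof (rule ccontr)
    assume "\<not> t \<le> 1 / \<epsilon>"
    then have "1 / \<epsilon> < t" by simp
    moreover from this have t_pos: "0 < t"
      using \<epsilon>(1) by (meson less_trans zero_less_divide_1_iff)
    ultimately have t: "0 < t" "1 / t < \<epsilon>"
      using \<epsilon>(1) by (simp_all add: field_simps)
    then have "F (1 / t) (F t x) \<noteq> x" using that \<epsilon>(2)[of "1 / t" "F t x"] by (auto simp: S_def)
    then show False using F_inverse t x by blast
  qed
  then have bdd: "bdd_above S" by (meson bdd_aboveI)
  have "closedin (top_of_set {0..}) S"
    using closedin_continuous_map_preimage[OF continuous_orbit[OF x(1)] closedin_D] by (simp add: S_def)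
  then have "closed S" by (metis closed_atLeast closedin_closed_trans)
  define T where "T = Sup S"
  have TS: "T \<in> S" unfolding T_def using zero bdd \<open>closed S\<close> by (intro closed_contains_Sup) auto
  have op: "openin (top_of_set {0..}) {t \<in> {0..}. F t x \<in> X interior_of D}"
    using openin_continuous_map_preimage[OF continuous_orbit[OF x(1)] openin_interior_of] by simp
  have "F T x \<notin> X interior_of D"
  proof
    assume "F T x \<in> X interior_of D"
    then have "T \<in> {t \<in> {0..}. F t x \<in> X interior_of D}" using TS by (simp add: S_def)
    then obtain e where e: "0 < e" "ball T e \<inter> {0..} \<subseteq> {t \<in> {0..}. F t x \<in> X interior_of D}"
      using op by (meson openin_contains_ball)
    \<comment> \<open>If \<open>F T x\<close> were interior, the orbit would remain in
      \<open>D\<close> a little beyond the supremum \<open>T\<close>.\<close>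
    have "T + e / 2 \<in> ball T e \<inter> {0..}" using e TS by (auto simp: dist_real_def S_def)
    then have "T + e / 2 \<in> S" using e interior_of_subset[of X D] by (auto simp: S_def)
    then have "T + e / 2 \<le> T" unfolding T_def using bdd by (intro cSup_upper)
    then show False using e by simp
  qed
  then have fr: "F T x \<in> X frontier_of D" using TS by (auto simp: frontier_eq S_def)
  have "T \<noteq> 0" using fr x base_notin_frontier by (auto simp: F_zero)
  then show thesis using TS fr by (intro that[of T]) (auto simp: S_def)
qed

text \<open>Injectivity of \<open>F\<close> separates the constant map from the identity, so some
  point differs from \<open>x0\<close>, and its orbit meets the frontier.\<close>

lemma frontier_nonempty: "X frontier_of D \<noteq> {}"
proof -
  have "F 0 \<noteq> F 1" using inj_onD[OF inj_F, of 0 1] by auto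
  then obtain x where "x \<in> topspace X" "x \<noteq> x0"
    unfolding F_zero F_one by (auto simp: restrict_def fun_eq_iff split: if_splits)
  then show ?thesis using frontier_time_exists by blast
qed

lemma frontier_subset: "X frontier_of D \<subseteq> topspace X"
  by (rule frontier_of_subset_topspace)

lemma frontier_decomposition:
  assumes "x \<in> topspace X" "x \<noteq> x0"
  obtains T c where "0 < T" "c \<in> X frontier_of D" "c = F T x" "x = F (1 / T) c"
proof -
  obtain T where "0 < T" "F T x \<in> X frontier_of D"
    using frontier_time_exists[OF assms] .
  then show thesis using that[of T "F T x"] F_inverse[of T x] assms by simp
qed

lemma interior_eq: "(\<Union>\<alpha>\<in>{0..<1}. F \<alpha> ` D) = X interior_of D"
proof (rule equalityI[OF contracting subsetI])
  fix x assume x: "x \<in> X interior_of D"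
  then have xD: "x \<in> D" "x \<in> topspace X" using interior_of_subset[of X D] D_subset by auto
  show "x \<in> (\<Union>\<alpha>\<in>{0..<1}. F \<alpha> ` D)"
  proof (cases "x = x0")
    case True
    have "x0 = F 0 x0" using x0 by (simp add: F_zero)
    then have "x \<in> F 0 ` D" using True xD by blast
    then show ?thesis by (intro UN_I[of 0]) auto
  next
    case False
    obtain T c where T: "0 < T" "c \<in> X frontier_of D" "c = F T x" "x = F (1 / T) c"
      by (rule frontier_decomposition[OF xD(2) False])
    have FT: "F T x \<in> D" "F T x \<notin> X interior_of D" using T(2,3) by (auto simp: frontier_eq)
    \<comment> \<open>At time 1 the orbit is at \<open>x\<close>, a point of \<open>D\<close>, so
      every earlier time is interior and cannot be the frontier time. Time 1 itself is excluded
      because \<open>x\<close> is interior.\<close>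
    have "\<not> T < 1" using orbit_interior[of T 1 x] T(1) xD FT by (auto simp: F_one)
    moreover have "T \<noteq> 1" using FT x xD by (auto simp: F_one)
    ultimately have "1 / T \<in> {0..<1}" by simp
    moreover have "x \<in> F (1 / T) ` D" using FT(1) T(3,4) by blast
    ultimately show ?thesis by (rule UN_I)
  qed
qed

section \<open>Properness of the action on the frontier cylinder\<close>

abbreviation action_on_frontier :: "real \<times> 'a \<Rightarrow> 'a"
  where "action_on_frontier \<equiv> \<lambda>(t, c). F t c"

abbreviation cylinder :: "(real \<times> 'a) topology"
  where "cylinder \<equiv> prod_topology (top_of_set {0..}) (subtopology X (X frontier_of D))"

lemma topspace_cylinder: "topspace cylinder = {0..} \<times> X frontier_of D"
  using frontier_subset by auto

lemma continuous_action_on_frontier: "continuous_map cylinder X action_on_frontier"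
proof -
  have "cylinder = subtopology (prod_topology (top_of_set {0..}) X) ({0..} \<times> X frontier_of D)"
    by (simp add: prod_topology_subtopology(2))
  then show ?thesis using continuous_action by (simp add: continuous_map_from_subtopology)
qed

lemma action_on_frontier_surj: "action_on_frontier ` topspace cylinder = topspace X"
proof
  show "action_on_frontier ` topspace cylinder \<subseteq> topspace X"
    using continuous_action_on_frontier by (rule continuous_map_image_subset_topspace)
  show "topspace X \<subseteq> action_on_frontier ` topspace cylinder"
  proof
    fix x assume x: "x \<in> topspace X"
    show "x \<in> action_on_frontier ` topspace cylinder"
    proof (cases "x = x0")
      case True
      \<comment> \<open>Every frontier point reaches \<open>x0\<close> at time 0, so any one will
        do.\<close>
      obtain c where c: "c \<in> X frontier_of D" using frontier_nonempty by blast
      then have "x = F 0 c" using True frontier_subset by (auto simp: F_zero)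
      then show ?thesis
        using c unfolding topspace_cylinder by (intro image_eqI[of _ _ "(0, c)"]) auto
    next
      case False
      obtain T c where T: "0 < T" "c \<in> X frontier_of D" "c = F T x" "x = F (1 / T) c"
        by (rule frontier_decomposition[OF x False])
      have "(1 / T, c) \<in> topspace cylinder"
        using T(1,2) unfolding topspace_cylinder by simp
      then show ?thesis
        by (rule image_eqI[rotated]) (simp flip: T(4))
    qed
  qed
qed

text \<open>Times in the preimage are bounded, which makes it a closed subset of a compact
  box.\<close>

lemma compactin_action_on_frontier_preimage:
  assumes K: "compactin X K"
  shows "compactin cylinder {z \<in> topspace cylinder. action_on_frontier z \<in> K}"
proof -
  obtain \<epsilon> where \<epsilon>: "0 < \<epsilon>" "\<And>t x. 0 \<le> t \<Longrightarrow> t < \<epsilon> \<Longrightarrow> x \<in> K \<Longrightarrow> F t x \<in> X interior_of D"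
    using shrinks_into_neighbourhood[OF K openin_interior_of x0_interior] by blast
  have "t \<le> 2 / \<epsilon>" if "0 \<le> t" "c \<in> X frontier_of D" "F t c \<in> K" for t c
  proof (rule ccontr)
    assume "\<not> t \<le> 2 / \<epsilon>"
    then have "1 < \<epsilon> / 2 * t" using \<epsilon>(1) by (simp add: field_simps)
    \<comment> \<open>Shrinking \<open>F t c\<close> by the admissible factor
      \<open>\<epsilon> / 2\<close> lands in the interior at a time still beyond 1, so
      \<open>c\<close> itself, the orbit at time 1, would be interior.\<close>
    moreover have "F (\<epsilon> / 2 * t) c \<in> X interior_of D"
      using \<epsilon>(2)[of "\<epsilon> / 2" "F t c"] F_mult[of "\<epsilon> / 2" t c] that \<epsilon>(1) frontier_subset by auto
    ultimately have "F 1 c \<in> X interior_of D"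
      using orbit_interior[of 1 "\<epsilon> / 2 * t" c] that frontier_subset interior_of_subset[of X D] by auto
    then show False using that frontier_subset by (auto simp: F_one frontier_eq)
  qed
  then have "{z \<in> topspace cylinder. action_on_frontier z \<in> K} \<subseteq> {0..2 / \<epsilon>} \<times> X frontier_of D"
    unfolding topspace_cylinder by auto
  moreover have "compactin cylinder ({0..2 / \<epsilon>} \<times> X frontier_of D)"
    using compactin_frontier by (auto simp: compactin_Times compactin_subtopology)
  moreover have "closedin cylinder {z \<in> topspace cylinder. action_on_frontier z \<in> K}"
    by (rule closedin_continuous_map_preimage[OF continuous_action_on_frontier
          compactin_imp_closedin[OF Hausdorff K]])
  ultimately show ?thesis by (blast intro: closed_compactin)
qed

text \<open>\<open>X\<close> is a k-space by local compactness and a KC-space by the Hausdorff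
  property, so a continuous surjection onto it with compact preimages of compact sets is perfect,
  hence a quotient map.\<close>

lemma quotient_action_on_frontier: "quotient_map cylinder X action_on_frontier"
  using locally_compact_imp_k_space[OF locally_compact] Hausdorff_imp_kc_space[OF Hausdorff]
    action_on_frontier_surj continuous_action_on_frontier compactin_action_on_frontier_preimage
  by (blast intro: perfect_imp_quotient_map compact_imp_perfect_map)

section \<open>Passage from the cylinder to the cone\<close>

abbreviation cone_map :: "'a + real \<times> 'a \<Rightarrow> 'a"
  where "cone_map \<equiv> \<lambda>z. case z of Inl p \<Rightarrow> x0 | Inr (\<alpha>, c) \<Rightarrow> F \<alpha> c"

abbreviation cone :: "('a + real \<times> 'a) topology"
  where "cone \<equiv> cone_topology x0 {0..} (subtopology X (X frontier_of D))"

lemma cone_map_proj: "z \<in> topspace cylinder \<Longrightarrow> cone_map (cone_proj x0 z) = action_on_frontier z"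
  using frontier_subset unfolding topspace_cylinder by (auto simp: cone_proj_def F_zero)

text \<open>The composite with the projection from the cylinder is a quotient map, and so is the
  projection; hence the remaining factor is one too.\<close>

lemma quotient_cone_map: "quotient_map cone X cone_map"
proof -
  have proj: "quotient_map cylinder cone (cone_proj x0)"
    using frontier_nonempty frontier_subset by (intro quotient_map_cone_proj) auto
  have "quotient_map cylinder X (cone_map \<circ> cone_proj x0)"
    by (rule quotient_map_eq[OF quotient_action_on_frontier]) (simp add: cone_map_proj)
  then show ?thesis
    using quotient_map_compose_eq[OF proj] by blast
qed

lemma inj_on_cone_map: "inj_on cone_map (topspace cone)"
proof -
  have ne: "F t c \<noteq> x0" if "0 < t" "c \<in> X frontier_of D" for t c
    using that F_eq_base_iff[of t c] frontier_subset base_notin_frontier by auto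
  have eq: "s = t \<and> c = d"
    if "0 < s" "0 < t" "c \<in> X frontier_of D" "d \<in> X frontier_of D" "F s c = F t d" for s t c d
  proof -
    have cd: "c \<in> topspace X" "d \<in> topspace X" using that frontier_subset by auto
    \<comment> \<open>Both \<open>c\<close> and \<open>d\<close> lie on the orbit of the common
      image, at times \<open>1 / s\<close> and \<open>1 / t\<close>; uniqueness of the frontier time
      makes these equal.\<close>
    have c: "F (1 / s) (F s c) = c" and d: "F (1 / t) (F s c) = d"
      using F_inverse[OF that(1) cd(1)] F_inverse[OF that(2) cd(2)] that(5) by simp_all
    then have "1 / s = 1 / t"
      using frontier_time_unique[of "1 / s" "1 / t" "F s c"] that(1-4) cd F_closed by simp
    then show ?thesis using c d by simp
  qed
  have cone_cases: "y = Inl x0 \<or> (\<exists>t c. 0 < t \<and> c \<in> X frontier_of D \<and> y = Inr (t, c))"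
    if "y \<in> topspace cone" for y
    using that by (auto simp: cone_carrier_def)
  show ?thesis
  proof (rule inj_onI)
    fix y z assume yz: "y \<in> topspace cone" "z \<in> topspace cone" and image: "cone_map y = cone_map z"
    consider "y = Inl x0" "z = Inl x0"
      | t c where "y = Inl x0" "z = Inr (t, c)" "0 < t" "c \<in> X frontier_of D"
      | s c where "y = Inr (s, c)" "z = Inl x0" "0 < s" "c \<in> X frontier_of D"
      | s t c d where "y = Inr (s, c)" "z = Inr (t, d)" "0 < s" "0 < t"
          "c \<in> X frontier_of D" "d \<in> X frontier_of D"
      using cone_cases[OF yz(1)] cone_cases[OF yz(2)] by blast
    then show "y = z"
    proof cases
      case 1
      then show ?thesis by simp
    next
      case (2 t c)
      then show ?thesis using image ne[of t c] by simp
    next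
      case (3 s c)
      then show ?thesis using image ne[of s c] by simp
    next
      case (4 s t c d)
      then show ?thesis using image eq[of s t c d] by simp
    qed
  qed
qed

lemma homeomorphic_cone_map: "homeomorphic_map cone X cone_map"
  unfolding homeomorphic_map_def using quotient_cone_map inj_on_cone_map by (rule conjI)

end

theorem proposition2p9:
  fixes X :: "'a topology" and x0 :: 'a and F :: "real \<Rightarrow> 'a \<Rightarrow> 'a" and D :: "'a set"
  assumes "locally_compact_space X" and "Hausdorff_space X"
    and "x0 \<in> topspace X"
    and "continuous_map (top_of_set {0..}) (pointed_maps_topology X x0) F"
    and "inj_on F {0..}"
    and "F \<in> hom nonneg_real_monoid (pointed_maps_monoid X x0)"
    and "F 0 = (\<lambda>x\<in>topspace X. x0)"
    and "F 1 = (\<lambda>x\<in>topspace X. x)"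
    and "compactin X D"
    and "x0 \<in> X interior_of D"
    and "(\<Union>\<alpha>\<in>{0..<1}. F \<alpha> ` D) \<subseteq> X interior_of D"
  shows "(\<Union>\<alpha>\<in>{0..<1}. F \<alpha> ` D) = X interior_of D \<and>
    homeomorphic_map (cone_topology x0 {0..} (subtopology X (X frontier_of D))) X
      (\<lambda>z. case z of Inl p \<Rightarrow> x0 | Inr (\<alpha>, c) \<Rightarrow> F \<alpha> c)"
proof -
  interpret contracting_action X x0 F D
    using assms by (rule contracting_action.intro)
  show ?thesis using interior_eq homeomorphic_cone_map by (rule conjI)
qed

end
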